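(* Let $(\rho(\theta))_{\theta\in\mathbb{R}^L}$ be a second-order differentiable parameterized family of positive definite states on a finite-dimensional Hilbert space. Then for all $\theta\in\mathbb{R}^L$ the Belavkin--Staszewski information matrix equals the RLD information matrix: $$\widehat I(\theta)=I_{\mathrm{RLD}}(\theta).$$
   Context: A state is a positive semi-definite operator of unit trace. For positive definite states $\rho,\sigma$, the Belavkin--Staszewski relative entropy is $\widehat D(\rho\|\sigma):=\mathrm{Tr}[\rho\ln(\rho^{1/2}\sigma^{-1}\rho^{1/2})]$. The Belavkin--Staszewski information matrix has entries $[\widehat I(\theta)]_{i,j}:=\left.\frac{\partial^2}{\partial\varepsilon_i\partial\varepsilon_j}\widehat D(\rho(\theta)\|\rho(\theta+\varepsilon))\right|_{\varepsilon=0}$. The right-logarithmic derivative (RLD) information matrix has entries $[I_{\mathrm{RLD}}(\theta)]_{i,j}:=\mathrm{Re}\,\mathrm{Tr}[(\partial_i\rho(\theta))\rho(\theta)^{-1}(\partial_j\rho(\theta))]=\frac12\mathrm{Tr}[\{\partial_i\rho(\theta),\partial_j\rho(\theta)\}\rho(\theta)^{-1}]$, where $\partial_i=\partial/\partial\theta_i$ and $\{A,B\}=AB+BA$. *)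

theory Defs
  imports "HOL-Analysis.Analysis"
begin

text \<open>
  Operators on an \<open>n\<close>-dimensional Hilbert space are complex matrices with respect to an
  orthonormal basis, i.e.\ elements of \<^typ>\<open>complex^'n^'n\<close>.
\<close>

definition conj_transpose :: "complex^'n^'m \<Rightarrow> complex^'m^'n"
  where "conj_transpose A = map_matrix cnj (transpose A)"

definition cinner :: "complex^'n \<Rightarrow> complex^'n \<Rightarrow> complex"
  where "cinner x y = (\<Sum>i\<in>UNIV. cnj (x $ i) * y $ i)"

definition hermitian :: "complex^'n^'n \<Rightarrow> bool"
  where "hermitian A \<longleftrightarrow> conj_transpose A = A"

text \<open>For Hermitian \<open>A\<close> the form \<open>cinner x (A *v x)\<close> is real, so taking \<^const>\<open>Re\<close> loses nothing.\<close>

definition pos_semidef :: "complex^'n^'n \<Rightarrow> bool"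
  where "pos_semidef A \<longleftrightarrow> hermitian A \<and> (\<forall>x. 0 \<le> Re (cinner x (A *v x)))"

definition pos_def :: "complex^'n^'n \<Rightarrow> bool"
  where "pos_def A \<longleftrightarrow> hermitian A \<and> (\<forall>x. x \<noteq> 0 \<longrightarrow> 0 < Re (cinner x (A *v x)))"

definition state :: "complex^'n^'n \<Rightarrow> bool"
  where "state \<rho> \<longleftrightarrow> pos_semidef \<rho> \<and> trace \<rho> = 1"

definition unitary :: "complex^'n^'n \<Rightarrow> bool"
  where "unitary U \<longleftrightarrow> U ** conj_transpose U = mat 1 \<and> conj_transpose U ** U = mat 1"

definition diag_matrix :: "('n \<Rightarrow> real) \<Rightarrow> complex^'n^'n"
  where "diag_matrix d = (\<chi> i j. if i = j then complex_of_real (d i) else 0)"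

text \<open>
  Functional calculus for Hermitian matrices: \<open>f (U diag(d) U\<^sup>*) = U diag(f d) U\<^sup>*\<close>.
  The right-hand side does not depend on the chosen spectral decomposition, so the description
  is unique; for non-Hermitian arguments the value is unspecified.
\<close>

definition matrix_fun :: "(real \<Rightarrow> real) \<Rightarrow> complex^'n^'n \<Rightarrow> complex^'n^'n"
  where "matrix_fun f A =
    (THE B. \<exists>U d. unitary U \<and> A = U ** diag_matrix d ** conj_transpose U \<and>
                  B = U ** diag_matrix (\<lambda>i. f (d i)) ** conj_transpose U)"

text \<open>
  For positive definite \<open>\<rho>\<close>, \<open>\<sigma>\<close> the trace below is that of a product of two Hermitian matrices,
  hence real.
\<close>

definition BS_relative_entropy :: "complex^'n^'n \<Rightarrow> complex^'n^'n \<Rightarrow> real"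
  where "BS_relative_entropy \<rho> \<sigma> =
    Re (trace (\<rho> ** matrix_fun ln (matrix_fun sqrt \<rho> ** matrix_inv \<sigma> ** matrix_fun sqrt \<rho>)))"

definition partial_deriv :: "'l \<Rightarrow> (real^'l \<Rightarrow> 'b::real_normed_vector) \<Rightarrow> real^'l \<Rightarrow> 'b"
  where "partial_deriv i f x = vector_derivative (\<lambda>t. f (x + t *\<^sub>R axis i 1)) (at 0)"

text \<open>Twice (Frechet) differentiable on the whole space.\<close>

definition twice_differentiable :: "('a::real_normed_vector \<Rightarrow> 'b::real_normed_vector) \<Rightarrow> bool"
  where "twice_differentiable f \<longleftrightarrow>
    (\<exists>f' :: 'a \<Rightarrow> 'a \<Rightarrow>\<^sub>L 'b.
       (\<forall>x. (f has_derivative blinfun_apply (f' x)) (at x)) \<and> (\<forall>x. f' differentiable (at x)))"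

definition BS_information :: "(real^'l \<Rightarrow> complex^'n^'n) \<Rightarrow> real^'l \<Rightarrow> real^'l^'l"
  where "BS_information \<rho> \<theta> =
    (\<chi> i j. partial_deriv i (partial_deriv j (\<lambda>\<epsilon>. BS_relative_entropy (\<rho> \<theta>) (\<rho> (\<theta> + \<epsilon>)))) 0)"

definition RLD_information :: "(real^'l \<Rightarrow> complex^'n^'n) \<Rightarrow> real^'l \<Rightarrow> real^'l^'l"
  where "RLD_information \<rho> \<theta> =
    (\<chi> i j. Re (trace (partial_deriv i \<rho> \<theta> ** matrix_inv (\<rho> \<theta>) ** partial_deriv j \<rho> \<theta>)))"

end

theory Submission
  imports Defs
begin

text \<open>
  Write \<open>\<Delta> = \<rho>(\<theta> + \<epsilon>) - \<rho>(\<theta>)\<close>, \<open>Q = \<rho>(\<theta>)\<^sup>-\<^sup>1\<^sup>/\<^sup>2\<close> and \<open>Z = Q \<Delta> Q\<close>. The argument of the logarithm in the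
  relative entropy is \<open>(1 + Z)\<^sup>-\<^sup>1\<close>, and near \<open>\<epsilon> = 0\<close> its logarithm is
  \<open>- (Z - Z\<^sup>2 / 2 + R(Z))\<close>, where \<open>R\<close> collects the terms of order at least three of the power series.
  By cyclicity of the trace, \<open>Tr[\<rho>(\<theta>) Z] = Tr[\<Delta>] = 0\<close> and
  \<open>Tr[\<rho>(\<theta>) Z\<^sup>2] = Tr[\<Delta> \<rho>(\<theta>)\<^sup>-\<^sup>1 \<Delta>]\<close>, so the relative entropy is
  \<open>Tr[\<Delta> \<rho>(\<theta>)\<^sup>-\<^sup>1 \<Delta>] / 2 - Tr[\<rho>(\<theta>) R(Z)]\<close>. The second derivative of the first term is the
  RLD information; the first derivatives of the second term are quadratically small in \<open>\<epsilon>\<close>, so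
  its second derivatives at \<open>0\<close> vanish.
\<close>

subsection \<open>Complex matrices\<close>

text \<open>In finite dimensions bilinearity already gives boundedness. The interpretation below
  supplies the product rule, continuity and the constant for norms of products.\<close>

lemma bounded_bilinear_matrix_mult:
  "bounded_bilinear ((**) :: complex^'m^'n \<Rightarrow> complex^'p^'m \<Rightarrow> complex^'p^'n)"
  unfolding bilinear_conv_bounded_bilinear [symmetric] bilinear_def
  by (auto intro!: linearI
      simp: matrix_add_ldistrib matrix_matrix_mult_def vec_eq_iff sum.distrib scaleR_sum_right
        algebra_simps)

interpretation matmul: bounded_bilinear "(**) :: complex^'m^'n \<Rightarrow> complex^'p^'m \<Rightarrow> complex^'p^'n"
  by (rule bounded_bilinear_matrix_mult)

lemma bounded_bilinear_matrix_vector_mult: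
  "bounded_bilinear ((*v) :: complex^'m^'n \<Rightarrow> complex^'m \<Rightarrow> complex^'n)"
  unfolding bilinear_conv_bounded_bilinear [symmetric] bilinear_def
  by (auto intro!: linearI
      simp: matrix_vector_mult_def vec_eq_iff sum.distrib scaleR_sum_right algebra_simps)

interpretation matvec: bounded_bilinear "(*v) :: complex^'m^'n \<Rightarrow> complex^'m \<Rightarrow> complex^'n"
  by (rule bounded_bilinear_matrix_vector_mult)

lemma bounded_linear_Re_trace: "bounded_linear (\<lambda>A :: complex^'n^'n. Re (trace A))"
  unfolding linear_conv_bounded_linear [symmetric]
  by (rule linearI) (simp_all add: trace_def sum.distrib scaleR_sum_right sum_distrib_left)

lemma bounded_linear_conj_transpose:
  "bounded_linear (conj_transpose :: complex^'n^'m \<Rightarrow> complex^'m^'n)"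
  unfolding linear_conv_bounded_linear [symmetric]
  by (rule linearI) (simp_all add: conj_transpose_def vec_eq_iff transpose_def)

lemma conj_transpose_nth [simp]: "conj_transpose A $ i $ j = cnj (A $ j $ i)"
  by (simp add: conj_transpose_def transpose_def)

lemma conj_transpose_conj_transpose [simp]: "conj_transpose (conj_transpose A) = A"
  by (simp add: vec_eq_iff)

lemma conj_transpose_mult: "conj_transpose (A ** B) = conj_transpose B ** conj_transpose A"
  by (simp add: vec_eq_iff matrix_matrix_mult_def mult.commute)

lemma trace_conj_transpose: "trace (conj_transpose A) = cnj (trace A)"
  by (simp add: trace_def)

text \<open>Taking adjoints reverses the product and conjugates its trace. This later undoes the
  symmetrisation of the second-order form.\<close>

lemma Re_trace_mult3_hermitian:
  assumes "hermitian A" "hermitian B" "hermitian C"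
  shows "Re (trace (A ** B ** C)) = Re (trace (C ** B ** A))"
proof -
  have "conj_transpose (A ** B ** C) = C ** B ** A"
    using assms by (simp add: conj_transpose_mult hermitian_def matrix_mul_assoc)
  then show ?thesis
    using trace_conj_transpose [of "A ** B ** C"] by simp
qed

lemma cinner_conj_transpose: "cinner (A *v x) y = cinner x (conj_transpose A *v y)"
  unfolding cinner_def matrix_vector_mult_def
  by (simp add: sum_distrib_left sum_distrib_right mult_ac) (rule sum.swap)

lemma cinner_hermitian: "hermitian A \<Longrightarrow> cinner (A *v x) y = cinner x (A *v y)"
  by (simp add: cinner_conj_transpose hermitian_def)

lemma cinner_commute: "cinner y x = cnj (cinner x y)"
  by (simp add: cinner_def mult.commute)

lemma cinner_scale_right [simp]: "cinner x (c *s y) = c * cinner x y"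
  by (simp add: cinner_def sum_distrib_left mult_ac)

lemma cinner_scale_left [simp]: "cinner (c *s x) y = cnj c * cinner x y"
  by (simp add: cinner_def sum_distrib_left mult_ac)

lemma cinner_add_right: "cinner x (y + z) = cinner x y + cinner x z"
  by (simp add: cinner_def sum.distrib algebra_simps)

text \<open>Links the complex form to the real inner product of the library, so that Euclidean
  orthogonality, dimension and norms become available.\<close>

lemma Re_cinner: "Re (cinner x y) = x \<bullet> y"
  by (simp add: cinner_def inner_vec_def inner_complex_def)

lemma cinner_self: "cinner x x = complex_of_real ((norm x)\<^sup>2)"
  by (rule complex_eqI)
    (simp_all add: Re_cinner power2_norm_eq_inner, simp add: cinner_def mult.commute)

lemma matrix_vector_scale: "A *v (c *s x) = c *s (A *v x)" for A :: "complex^'n^'m"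
  by (simp add: vec.scale)

lemma inner_hermitian: "hermitian A \<Longrightarrow> (A *v x) \<bullet> y = x \<bullet> (A *v y)"
  by (metis Re_cinner cinner_hermitian)

subsection \<open>Spectral decomposition\<close>

text \<open>A maximiser of the quadratic form on the unit sphere of an invariant subspace is an
  eigenvector: the first-order condition says that the residual is orthogonal to the subspace.\<close>

lemma hermitian_eigenvector_in_complement:
  fixes A :: "complex^'n^'n" and v :: "'i \<Rightarrow> complex^'n" and d :: "'i \<Rightarrow> real"
  assumes A: "hermitian A"
    and eig: "\<And>i. i \<in> I \<Longrightarrow> A *v v i = complex_of_real (d i) *s v i"
    and z: "z \<noteq> 0" "\<And>i. i \<in> I \<Longrightarrow> cinner (v i) z = 0"
  obtains x l where "norm x = 1" "\<And>i. i \<in> I \<Longrightarrow> cinner (v i) x = 0"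
    "A *v x = complex_of_real l *s x"
proof -
  define S where "S = {x. \<forall>i\<in>I. cinner (v i) x = 0}"
  define q where "q x = x \<bullet> (A *v x)" for x
  have S_scale: "c *s x \<in> S" if "x \<in> S" for c x
    using that by (simp add: S_def)
  have S_add: "x + y \<in> S" if "x \<in> S" "y \<in> S" for x y
    using that by (simp add: S_def cinner_add_right)
  have scaleR: "r *\<^sub>R x = complex_of_real r *s x" for r and x :: "complex^'n"
    by (simp add: vec_eq_iff complex_eq_iff)
  have S_A: "A *v x \<in> S" if "x \<in> S" for x
    using that by (simp add: S_def cinner_hermitian [OF A, symmetric] eig)
  have cont_cinner: "continuous_on UNIV (\<lambda>x. cinner w x)" for w :: "complex^'n"
    unfolding cinner_def by (intro continuous_intros)
  have "S = (\<Inter>i\<in>I. {x. cinner (v i) x = 0})"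
    by (auto simp: S_def)
  moreover have "closed {x. cinner (v i) x = 0}" for i
    by (intro closed_Collect_eq cont_cinner continuous_on_const)
  ultimately have "closed S"
    by auto
  then have "compact (sphere 0 1 \<inter> S)"
    by (intro compact_Int_closed compact_sphere)
  moreover have "(1 / norm z) *\<^sub>R z \<in> sphere 0 1 \<inter> S"
    using z by (auto simp: S_def) (simp add: scaleR)
  moreover have "continuous_on (sphere 0 1 \<inter> S) q"
    unfolding q_def by (intro continuous_intros matvec.continuous_on)
  ultimately have "\<exists>x\<in>sphere 0 1 \<inter> S. \<forall>y\<in>sphere 0 1 \<inter> S. q y \<le> q x"
    by (intro continuous_attains_sup) blast+
  then obtain x where x: "norm x = 1" "x \<in> S"
    and max: "\<And>y. norm y = 1 \<Longrightarrow> y \<in> S \<Longrightarrow> q y \<le> q x"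
    by auto
  have q_scale: "q (r *\<^sub>R y) = r\<^sup>2 * q y" for r y
    by (simp add: q_def matvec.scaleR_right power2_eq_square)
  have q_le: "q y \<le> q x * (norm y)\<^sup>2" if "y \<in> S" for y
  proof (cases "y = 0")
    case False
    then have "q ((1 / norm y) *\<^sub>R y) \<le> q x"
      using that by (intro max) (simp, simp add: scaleR S_scale)
    then show ?thesis
      using False unfolding q_scale by (simp add: field_simps)
  qed (simp add: q_def)
  define r where "r = q x *\<^sub>R x - A *v x"
  have r: "r \<in> S"
    using S_add [OF S_scale [OF x(2), of "q x"] S_scale [OF S_A [OF x(2)], of "- 1"]]
    by (simp add: r_def scaleR)
  have r_r: "q x * (x \<bullet> r) - (A *v x) \<bullet> r = r \<bullet> r"
    by (simp add: r_def inner_diff_left)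
  \<comment> \<open>The residual itself is the direction of variation. Since
    \<open>norm x = 1\<close>, this function of \<open>t\<close> vanishes at \<open>0\<close>, and
    by \<open>q_le\<close> it is nonnegative; so its derivative there is zero, which gives
    \<open>r = 0\<close>.\<close>
  have "((\<lambda>t. q x * (norm (x + t *\<^sub>R r))\<^sup>2 - q (x + t *\<^sub>R r)) has_real_derivative 2 * (r \<bullet> r)) (at 0)"
  proof -
    have "q x * (norm (x + t *\<^sub>R r))\<^sup>2 - q (x + t *\<^sub>R r)
        = q x * (x \<bullet> x) - q x + t * (2 * (r \<bullet> r)) + t\<^sup>2 * (q x * (r \<bullet> r) - q r)" for t
    proof -
      have "q (x + t *\<^sub>R r) = q x + 2 * t * ((A *v x) \<bullet> r) + t\<^sup>2 * q r"
        using inner_hermitian [OF A, of x r]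
        by (simp add: q_def matvec.add_right matvec.scaleR_right inner_simps power2_eq_square
            algebra_simps inner_commute)
      moreover have "t * (r \<bullet> r) = t * (q x * (x \<bullet> r)) - t * ((A *v x) \<bullet> r)"
        unfolding r_r [symmetric] by (simp add: algebra_simps)
      ultimately show ?thesis
        unfolding power2_norm_eq_inner
        by (simp add: inner_simps power2_eq_square algebra_simps inner_commute)
    qed
    moreover have "((\<lambda>t. q x * (x \<bullet> x) - q x + t * (2 * (r \<bullet> r)) + t\<^sup>2 * (q x * (r \<bullet> r) - q r))
        has_real_derivative 2 * (r \<bullet> r)) (at 0)"
      by (auto intro!: derivative_eq_intros)
    ultimately show ?thesis
      by simp
  qed
  moreover have "q x * (norm (x + 0 *\<^sub>R r))\<^sup>2 - q (x + 0 *\<^sub>R r)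
      \<le> q x * (norm (x + t *\<^sub>R r))\<^sup>2 - q (x + t *\<^sub>R r)" for t
    using q_le [of "x + t *\<^sub>R r"] S_add [OF x(2) S_scale [OF r, of t]] x
    by (simp add: scaleR)
  ultimately have "2 * (r \<bullet> r) = 0"
    by (intro DERIV_local_min [of _ _ 0 1]) auto
  then have "A *v x = complex_of_real (q x) *s x"
    by (simp add: r_def scaleR)
  with x show ?thesis
    by (intro that) (auto simp: S_def)
qed

text \<open>Induction over the index set: an eigenvector is added in the orthogonal complement of
  those found so far. Indices from \<open>'n\<close> make the vectors for \<open>I = UNIV\<close>
  the columns of a square matrix.\<close>

lemma hermitian_orthonormal_eigenvectors:
  fixes A :: "complex^'n^'n" and I :: "'n set"
  assumes "hermitian A"
  shows "\<exists>(v :: 'n \<Rightarrow> complex^'n) d. \<forall>i\<in>I. A *v v i = complex_of_real (d i) *s v i \<and>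
    (\<forall>j\<in>I. cinner (v i) (v j) = (if i = j then 1 else 0))"
  using finite [of I]
proof induction
  case (insert k I)
  then obtain v :: "'n \<Rightarrow> complex^'n" and d
    where eig: "\<And>i. i \<in> I \<Longrightarrow> A *v v i = complex_of_real (d i) *s v i"
      and orth: "\<And>i j. i \<in> I \<Longrightarrow> j \<in> I \<Longrightarrow> cinner (v i) (v j) = (if i = j then 1 else 0)"
    by blast
  \<comment> \<open>Real orthogonality to both \<open>v i\<close> and \<open>\<i> *s v i\<close>
    amounts to complex orthogonality to \<open>v i\<close>. At most \<open>2 * card I\<close> real
    directions are used up, fewer than the real dimension \<open>2 * CARD('n)\<close>.\<close>
  let ?B = "v ` I \<union> (\<lambda>i. \<i> *s v i) ` I"
  have "dim ?B \<le> card ?B"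
    by (intro dim_le_card') auto
  also have "\<dots> \<le> card I + card I"
    by (intro order.trans [OF card_Un_le] add_mono card_image_le) auto
  also have "card I < CARD('n)"
    using insert.hyps by (intro psubset_card_mono) auto
  finally have "dim ?B < DIM(complex^'n)"
    by simp
  then obtain z where "z \<noteq> 0" and z: "\<And>y. y \<in> span ?B \<Longrightarrow> orthogonal z y"
    using orthogonal_to_subspace_exists by blast
  have z_orth: "cinner (v i) z = 0" if "i \<in> I" for i
  proof (rule complex_eqI)
    have "orthogonal z (v i)" "orthogonal z (\<i> *s v i)"
      using that by (auto intro!: z span_base)
    then show "Re (cinner (v i) z) = Re 0" "Im (cinner (v i) z) = Im 0"
      by (simp_all add: orthogonal_def Re_cinner [symmetric] cinner_commute [of z])
  qed
  then obtain x l where x: "norm x = 1" "\<And>i. i \<in> I \<Longrightarrow> cinner (v i) x = 0"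
    and "A *v x = complex_of_real l *s x"
    using hermitian_eigenvector_in_complement [where v = v and d = d and I = I,
        OF assms eig \<open>z \<noteq> 0\<close> z_orth]
    by metis
  moreover have "cinner x (v i) = 0" if "i \<in> I" for i
    using x(2) [OF that] by (simp add: cinner_commute [of x])
  moreover have "cinner x x = 1"
    using x by (simp add: cinner_self)
  ultimately show ?case
    using eig orth insert.hyps
    by (intro exI [of _ "v(k := x)"] exI [of _ "d(k := l)"]) auto
qed auto

section \<open>Spectral matrices and the functional calculus\<close>

definition spectral_matrix :: "complex^'n^'n \<Rightarrow> ('n \<Rightarrow> real) \<Rightarrow> complex^'n^'n"
  where "spectral_matrix U d = U ** diag_matrix d ** conj_transpose U"

lemma mult_diag_matrix_nth: "(U ** diag_matrix d) $ i $ j = U $ i $ j * complex_of_real (d j)"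
  by (simp add: matrix_matrix_mult_def diag_matrix_def if_distrib cong: if_cong)

lemma diag_matrix_mult_nth: "(diag_matrix d ** U) $ i $ j = complex_of_real (d i) * U $ i $ j"
  by (simp add: matrix_matrix_mult_def diag_matrix_def if_distrib if_distribR cong: if_cong)

lemma hermitian_spectral_decomposition:
  fixes A :: "complex^'n^'n"
  assumes "hermitian A"
  obtains U d where "unitary U" "A = spectral_matrix U d"
proof -
  obtain v :: "'n \<Rightarrow> complex^'n" and d
    where eig: "\<And>i. A *v v i = complex_of_real (d i) *s v i"
      and orth: "\<And>i j. cinner (v i) (v j) = (if i = j then 1 else 0)"
    using hermitian_orthonormal_eigenvectors [OF assms, of UNIV] by blast
  define U where "U = (\<chi> i j. v j $ i)"
  have "conj_transpose U ** U = mat 1"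
    using orth by (simp add: vec_eq_iff matrix_matrix_mult_def U_def cinner_def mat_def)
  then have U: "unitary U"
    by (simp add: unitary_def matrix_left_right_inverse)
  have "A ** U = U ** diag_matrix d"
    using eig
    by (simp add: vec_eq_iff mult_diag_matrix_nth)
      (simp add: matrix_matrix_mult_def matrix_vector_mult_def U_def mult.commute)
  then have "A = spectral_matrix U d"
    using U unfolding spectral_matrix_def unitary_def
    by (metis matrix_mul_assoc matrix_mul_rid)
  with U show ?thesis
    by (rule that)
qed

lemma diag_matrix_mult: "diag_matrix d ** diag_matrix e = diag_matrix (\<lambda>i. d i * e i)"
  by (simp add: vec_eq_iff mult_diag_matrix_nth) (simp add: diag_matrix_def)

lemma diag_matrix_1: "diag_matrix (\<lambda>i. 1) = mat 1"
  by (simp add: vec_eq_iff diag_matrix_def mat_def)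

lemma spectral_matrix_mult:
  assumes "unitary U"
  shows "spectral_matrix U d ** spectral_matrix U e = spectral_matrix U (\<lambda>i. d i * e i)"
  using assms unfolding spectral_matrix_def unitary_def diag_matrix_mult [symmetric]
  by (metis matrix_mul_assoc matrix_mul_rid)

lemma spectral_matrix_1: "unitary U \<Longrightarrow> spectral_matrix U (\<lambda>i. 1) = mat 1"
  by (simp add: spectral_matrix_def diag_matrix_1 unitary_def)

lemma hermitian_spectral_matrix: "hermitian (spectral_matrix U d)"
proof -
  have "conj_transpose (diag_matrix d) = diag_matrix d"
    by (simp add: vec_eq_iff diag_matrix_def)
  then show ?thesis
    by (simp add: hermitian_def spectral_matrix_def conj_transpose_mult matrix_mul_assoc)
qed

text \<open>For two spectral decompositions by \<open>U\<close> and \<open>V\<close>, the entries of \<open>V\<^sup>* U\<close> vanish unless the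
  corresponding eigenvalues agree, so it still intertwines the diagonals after applying \<open>f\<close>.\<close>

lemma matrix_fun_spectral_matrix:
  fixes U :: "complex^'n^'n"
  assumes U: "unitary U"
  shows "matrix_fun f (spectral_matrix U d) = spectral_matrix U (\<lambda>i. f (d i))"
  unfolding matrix_fun_def spectral_matrix_def [symmetric]
proof (rule the_equality)
  fix B
  assume "\<exists>V e. unitary V \<and> spectral_matrix U d = spectral_matrix V e \<and>
    B = spectral_matrix V (\<lambda>i. f (e i))"
  then obtain V e where V: "unitary V" and eq: "spectral_matrix U d = spectral_matrix V e"
    and B: "B = spectral_matrix V (\<lambda>i. f (e i))"
    by blast
  define W where "W = conj_transpose V ** U"
  \<comment> \<open>Stated for arbitrary diagonals because it is used twice: first to read off the
    intertwining of the eigenvalues, then in the other direction for their images under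
    \<open>f\<close>.\<close>
  have conj: "W ** diag_matrix d = diag_matrix e ** W \<longleftrightarrow> spectral_matrix U d = spectral_matrix V e"
    for d e
  proof
    assume "W ** diag_matrix d = diag_matrix e ** W"
    then have "V ** (W ** diag_matrix d) ** conj_transpose U =
        V ** (diag_matrix e ** W) ** conj_transpose U"
      by simp
    then show "spectral_matrix U d = spectral_matrix V e"
      using U V unfolding W_def spectral_matrix_def unitary_def
      by (metis matrix_mul_assoc matrix_mul_rid matrix_mul_lid)
  next
    assume "spectral_matrix U d = spectral_matrix V e"
    then have "conj_transpose V ** spectral_matrix U d ** U =
        conj_transpose V ** spectral_matrix V e ** U"
      by simp
    then show "W ** diag_matrix d = diag_matrix e ** W"
      using U V unfolding W_def spectral_matrix_def unitary_def
      by (metis matrix_mul_assoc matrix_mul_rid matrix_mul_lid)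
  qed
  have "W $ i $ j * complex_of_real (d j) = complex_of_real (e i) * W $ i $ j" for i j
    using conj [of d e] eq by (metis mult_diag_matrix_nth diag_matrix_mult_nth)
  then have "W $ i $ j = 0 \<or> d j = e i" for i j
    by (metis mult.commute mult_cancel_left of_real_eq_iff)
  then have "W ** diag_matrix (\<lambda>i. f (d i)) = diag_matrix (\<lambda>i. f (e i)) ** W"
    by (simp add: vec_eq_iff mult_diag_matrix_nth diag_matrix_mult_nth) (metis mult.commute)
  then show "B = spectral_matrix U (\<lambda>i. f (d i))"
    using conj [of "\<lambda>i. f (d i)" "\<lambda>i. f (e i)"] B by simp
qed (use U in blast)

text \<open>Column \<open>k\<close> of \<open>U\<close> is an eigenvector for \<open>d k\<close>;
  the quadratic form there is \<open>d k\<close> times a positive number.\<close>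

lemma spectral_matrix_pos_def:
  assumes U: "unitary U" and pd: "pos_def (spectral_matrix U d)"
  shows "0 < d k"
proof -
  define x where "x = U *v axis k 1"
  have Ux: "conj_transpose U *v x = axis k 1"
    using U by (simp add: x_def matrix_vector_mul_assoc unitary_def)
  then have "x \<noteq> 0"
    by (auto simp: axis_eq_0_iff)
  have "spectral_matrix U d *v x = U *v (diag_matrix d *v axis k 1)"
    by (simp add: Ux [symmetric] spectral_matrix_def matrix_vector_mul_assoc matrix_mul_assoc)
  also have "diag_matrix d *v axis k 1 = complex_of_real (d k) *s axis k 1"
    by (simp add: vec_eq_iff matrix_vector_mult_def diag_matrix_def axis_def
        if_distrib [where f = "(*) c" for c] cong: if_cong)
  also have "U *v (complex_of_real (d k) *s axis k 1) = complex_of_real (d k) *s x"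
    by (simp add: x_def matrix_vector_scale)
  finally have "cinner x (spectral_matrix U d *v x) = complex_of_real (d k * (norm x)\<^sup>2)"
    by (simp add: cinner_self)
  then show ?thesis
    using pd \<open>x \<noteq> 0\<close> by (auto simp: pos_def_def zero_less_mult_iff)
qed

text \<open>A one-sided inverse of a square matrix over a field is two-sided and unique, which pins
  down the choice in \<open>matrix_inv\<close>.\<close>

lemma matrix_inv_eqI: "A ** B = mat 1 \<Longrightarrow> matrix_inv A = B" for A B :: "'a::field^'n^'n"
  unfolding matrix_inv_def
  by (rule some_equality) (simp add: matrix_left_right_inverse, metis matrix_mul_assoc matrix_mul_lid matrix_mul_rid)

lemma pos_def_spectral_decomposition:
  fixes A :: "complex^'n^'n"
  assumes "pos_def A"
  obtains U d where "unitary U" "A = spectral_matrix U d" "\<And>i. 0 < d i"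
proof -
  obtain U d where U: "unitary U" "A = spectral_matrix U d"
    using hermitian_spectral_decomposition assms unfolding pos_def_def by blast
  with assms spectral_matrix_pos_def [OF U(1)] show ?thesis
    by (intro that) auto
qed

lemma spectral_matrix_mult_inverse:
  assumes "unitary U" "\<And>i. d i \<noteq> 0"
  shows "spectral_matrix U d ** spectral_matrix U (\<lambda>i. 1 / d i) = mat 1"
  using assms by (simp add: spectral_matrix_mult spectral_matrix_1)

lemma hermitian_matrix_inv_pos_def:
  assumes "pos_def A"
  shows "hermitian (matrix_inv A)"
proof -
  obtain U d where U: "unitary U" "A = spectral_matrix U d" and d: "\<And>i. 0 < d i"
    using pos_def_spectral_decomposition [OF assms] by blast
  have "matrix_inv A = spectral_matrix U (\<lambda>i. 1 / d i)"
    unfolding U(2) by (intro matrix_inv_eqI spectral_matrix_mult_inverse U(1) less_imp_neq [OF d, symmetric])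
  then show ?thesis
    by (simp add: hermitian_spectral_matrix)
qed

lemma spectral_matrix_nth:
  "spectral_matrix U d $ i $ j = (\<Sum>k\<in>UNIV. U $ i $ k * complex_of_real (d k) * cnj (U $ j $ k))"
  unfolding spectral_matrix_def matrix_matrix_mult_def [of "U ** diag_matrix d"]
  by (simp add: mult_diag_matrix_nth)

lemma spectral_matrix_diff:
  "spectral_matrix U d - spectral_matrix U e = spectral_matrix U (\<lambda>i. d i - e i)"
  by (simp add: vec_eq_iff spectral_matrix_nth sum_subtractf algebra_simps)

lemma spectral_matrix_scaleR: "a *\<^sub>R spectral_matrix U d = spectral_matrix U (\<lambda>i. a * d i)"
  by (simp add: vec_eq_iff spectral_matrix_nth scaleR_sum_right)
    (simp add: scaleR_conv_of_real mult_ac)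

lemma spectral_matrix_uminus: "- spectral_matrix U d = spectral_matrix U (\<lambda>i. - d i)"
  by (simp add: vec_eq_iff spectral_matrix_nth sum_negf)

text \<open>Each entry is a finite linear combination of eigenvalues, so scalar series for the
  eigenvalues sum to matrix series.\<close>

lemma sums_spectral_matrix:
  assumes "\<And>i. (\<lambda>n. d n i) sums s i"
  shows "(\<lambda>n. spectral_matrix U (d n)) sums spectral_matrix U s"
proof -
  have "(\<lambda>n. spectral_matrix U (d n) $ i $ j) sums (spectral_matrix U s $ i $ j)" for i j
    unfolding spectral_matrix_nth
    by (intro sums_sum sums_mult sums_mult2 sums_of_real assms)
  then show ?thesis
    unfolding sums_def by (intro vec_tendstoI) simp
qed

subsection \<open>The logarithm series\<close>

primrec mat_pow :: "complex^'n^'n \<Rightarrow> nat \<Rightarrow> complex^'n^'n" where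
  "mat_pow Z 0 = mat 1"
| "mat_pow Z (Suc k) = Z ** mat_pow Z k"

text \<open>\<open>Z\<close> and \<open>H\<close> need not commute, so the derivative of the
  \<open>k\<close>-th power at \<open>Z\<close> in direction \<open>H\<close> is the sum of
  \<open>Z^i H Z^(k-1-i)\<close> over \<open>i < k\<close>; the recursion is the product
  rule.\<close>

primrec mat_pow_deriv :: "complex^'n^'n \<Rightarrow> complex^'n^'n \<Rightarrow> nat \<Rightarrow> complex^'n^'n" where
  "mat_pow_deriv Z H 0 = 0"
| "mat_pow_deriv Z H (Suc k) = Z ** mat_pow_deriv Z H k + H ** mat_pow Z k"

lemma has_derivative_mat_pow:
  "((\<lambda>Z. mat_pow Z k) has_derivative (\<lambda>H. mat_pow_deriv Z H k)) (at Z within S)"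
  by (induction k) (auto intro!: matmul.FDERIV has_derivative_ident)

text \<open>\<open>K\<close> is a bound for the bilinear product, so \<open>K * norm Z\<close> acts
  as the ratio of a geometric series; \<open>norm (mat 1)\<close> accounts for the zeroth
  power.\<close>

lemma norm_mat_pow_le:
  fixes Z :: "complex^'n^'n"
  assumes K: "\<And>(A :: complex^'n^'n) (B :: complex^'n^'n). norm (A ** B) \<le> norm A * norm B * K" and "0 \<le> K"
  shows "norm (mat_pow Z k) \<le> norm (mat 1 :: complex^'n^'n) * (K * norm Z) ^ k"
proof (induction k)
  case (Suc k)
  have "norm (mat_pow Z (Suc k)) \<le> norm Z * norm (mat_pow Z k) * K"
    using K [of Z "mat_pow Z k"] by simp
  also have "\<dots> \<le> norm Z * (norm (mat 1 :: complex^'n^'n) * (K * norm Z) ^ k) * K"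
    using Suc \<open>0 \<le> K\<close> by (intro mult_right_mono mult_left_mono) auto
  finally show ?case
    by (simp add: mult_ac)
qed simp

text \<open>The derivative has \<open>k\<close> summands, each with one factor \<open>H\<close> and
  \<open>k - 1\<close> factors \<open>Z\<close>. At \<open>k = 0\<close> the truncated exponent is
  harmless because of the factor \<open>real k\<close>.\<close>

lemma norm_mat_pow_deriv_le:
  fixes Z :: "complex^'n^'n"
  assumes K: "\<And>(A :: complex^'n^'n) (B :: complex^'n^'n). norm (A ** B) \<le> norm A * norm B * K" and "0 \<le> K"
  shows "norm (mat_pow_deriv Z H k)
    \<le> real k * (K * norm (mat 1 :: complex^'n^'n) * norm H) * (K * norm Z) ^ (k - 1)"
proof (induction k)
  case (Suc k)
  let ?c = "norm (mat 1 :: complex^'n^'n)"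
  have "norm (mat_pow_deriv Z H (Suc k))
      \<le> norm Z * norm (mat_pow_deriv Z H k) * K + norm H * norm (mat_pow Z k) * K"
    by (auto intro!: norm_triangle_le add_mono K)
  also have "\<dots> \<le> norm Z * (real k * (K * ?c * norm H) * (K * norm Z) ^ (k - 1)) * K
      + norm H * (?c * (K * norm Z) ^ k) * K"
    using Suc norm_mat_pow_le [OF K \<open>0 \<le> K\<close>] \<open>0 \<le> K\<close>
    by (intro add_mono mult_right_mono mult_left_mono) auto
  also have "\<dots> = real (Suc k) * (K * ?c * norm H) * (K * norm Z) ^ k"
    by (cases k) (simp_all add: algebra_simps)
  finally show ?case
    by simp
qed simp

lemma norm_suminf_le_geometric_half:
  fixes f :: "nat \<Rightarrow> 'a::banach"
  assumes "\<And>n. norm (f n) \<le> c * (1/2) ^ n"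
  shows "summable f" "norm (suminf f) \<le> 2 * c"
proof -
  have sums: "(\<lambda>n. c * (1/2) ^ n) sums (c * 2)"
    using sums_mult [OF geometric_sums [of "1/2 :: real"], of c] by simp
  then show "summable f"
    using assms by (intro summable_comparison_test' [of "\<lambda>n. c * (1/2) ^ n" 0 f]) (auto simp: sums_iff)
  show "norm (suminf f) \<le> 2 * c"
    using norm_suminf_le [of f "\<lambda>n. c * (1/2) ^ n"] assms sums by (simp add: sums_iff)
qed

text \<open>\<open>ln_coeff 0 = 0\<close> because of \<open>x / 0 = 0\<close>.\<close>

definition ln_coeff :: "nat \<Rightarrow> real"
  where "ln_coeff n = - ((- 1) ^ n) / real n"

text \<open>The factor \<open>n\<close> from differentiating an \<open>n\<close>-th power cancels
  the denominator of the coefficient, leaving a geometric majorant.\<close>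

lemma abs_ln_coeff_mult: "n > 0 \<Longrightarrow> \<bar>ln_coeff n\<bar> * (real n * x) = x"
  by (simp add: ln_coeff_def)

text \<open>The series of \<open>ln (1 + Z)\<close> is cut after its quadratic term, and the tail
  \<open>R\<close> is differentiated term by term. Decay of the powers is recorded separately since
  it later locates the eigenvalues of \<open>Z\<close>.\<close>

lemma matrix_ln_series_remainder:
  obtains r C and R :: "complex^'n^'n \<Rightarrow> complex^'n^'n" and R'
  where "r > 0"
    "\<And>Z. Z \<in> ball 0 r \<Longrightarrow> (\<lambda>n. ln_coeff n *\<^sub>R mat_pow Z n) sums (Z - (1/2) *\<^sub>R (Z ** Z) + R Z)"
    "\<And>Z :: complex^'n^'n. Z \<in> ball 0 r \<Longrightarrow> (\<lambda>n. mat_pow Z n) \<longlonglongrightarrow> 0"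
    "\<And>Z. Z \<in> ball 0 r \<Longrightarrow> (R has_derivative R' Z) (at Z)"
    "\<And>Z H. Z \<in> ball 0 r \<Longrightarrow> norm (R' Z H) \<le> C * (norm Z)\<^sup>2 * norm H"
proof -
  obtain K where "K > 0"
    and K: "\<And>(A :: complex^'n^'n) (B :: complex^'n^'n). norm (A ** B) \<le> norm A * norm B * K"
    using matmul.pos_bounded by blast
  define c where "c = norm (mat 1 :: complex^'n^'n)"
  \<comment> \<open>With this radius \<open>K * norm Z\<close> is at most \<open>1/2\<close>, so
    geometric series of ratio \<open>1/2\<close> dominate.\<close>
  define r where "r = 1 / (2 * K)"
  \<comment> \<open>The shift by \<open>3\<close> drops the terms of order below three.\<close>
  define f where "f n Z = ln_coeff (n + 3) *\<^sub>R mat_pow Z (n + 3)" for n and Z :: "complex^'n^'n"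
  define f' where "f' n Z H = ln_coeff (n + 3) *\<^sub>R mat_pow_deriv Z H (n + 3)"
    for n and Z H :: "complex^'n^'n"
  define R' where "R' Z H = (\<Sum>n. f' n Z H)" for Z H
  have "r > 0"
    using \<open>K > 0\<close> by (simp add: r_def)
  have small: "K * norm Z \<le> 1/2" if "Z \<in> ball 0 r" for Z :: "complex^'n^'n"
    using that \<open>K > 0\<close> by (simp add: r_def field_simps)
  have f'_le: "norm (f' n Z H) \<le> (K^3 * c * (norm Z)\<^sup>2 * norm H) * (1/2) ^ n"
    if "Z \<in> ball 0 r" for n Z H
  proof -
    have "norm (f' n Z H)
        \<le> \<bar>ln_coeff (n + 3)\<bar> * (real (n + 3) * ((K * c * norm H) * (K * norm Z) ^ (n + 2)))"
      unfolding f'_def norm_scaleR c_def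
      using norm_mat_pow_deriv_le [OF K, of Z H "n + 3"] \<open>K > 0\<close>
      by (intro mult_left_mono) (simp_all add: mult_ac)
    also have "\<dots> = (K * c * norm H) * (K * norm Z) ^ (n + 2)"
      by (intro abs_ln_coeff_mult) simp
    \<comment> \<open>Two of the \<open>n + 2\<close> factors \<open>K * norm Z\<close> are kept as
      the quadratic bound; the others are then estimated by \<open>1/2\<close>.\<close>
    also have "\<dots> = (K^3 * c * (norm Z)\<^sup>2 * norm H) * (K * norm Z) ^ n"
      by (simp add: power_add power_mult_distrib power2_eq_square power3_eq_cube)
    also have "\<dots> \<le> (K^3 * c * (norm Z)\<^sup>2 * norm H) * (1/2) ^ n"
      using small [OF that] \<open>K > 0\<close> by (intro mult_left_mono power_mono) (auto simp: c_def)
    finally show ?thesis .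
  qed
  have R'_le: "norm (R' Z H) \<le> 2 * (K^3 * c) * (norm Z)\<^sup>2 * norm H" if "Z \<in> ball 0 r" for Z H
    using norm_suminf_le_geometric_half(2) [OF f'_le [OF that, of _ H]] by (simp add: R'_def mult_ac)
  \<comment> \<open>Replacing \<open>norm Z\<close> by \<open>r\<close> makes the tail estimate
    uniform on the ball, as termwise differentiation requires.\<close>
  define M where "M = 2 * (K^3 * c * r\<^sup>2)"
  have tail: "norm ((\<Sum>i<n. f' i Z H) - R' Z H) \<le> M * (1/2) ^ n * norm H"
    if Z: "Z \<in> ball 0 r" for n Z H
  proof -
    have "norm (f' (i + n) Z H) \<le> (K^3 * c * (norm Z)\<^sup>2 * norm H * (1/2)^n) * (1/2) ^ i" for i
      using f'_le [OF Z, of "i + n" H] by (simp add: power_add mult_ac)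
    then have "norm (\<Sum>i. f' (i + n) Z H) \<le> 2 * (K^3 * c * (norm Z)\<^sup>2 * norm H * (1/2)^n)"
      by (rule norm_suminf_le_geometric_half(2))
    also have "\<dots> \<le> 2 * (K^3 * c * r\<^sup>2 * norm H * (1/2)^n)"
      using Z \<open>K > 0\<close> by (intro mult_left_mono mult_right_mono power_mono) (auto simp: c_def)
    also have "(\<Sum>i. f' (i + n) Z H) = R' Z H - (\<Sum>i<n. f' i Z H)"
      unfolding R'_def
      by (rule suminf_minus_initial_segment [OF norm_suminf_le_geometric_half(1) [OF f'_le [OF Z]]])
    finally show ?thesis
      by (simp add: M_def norm_minus_commute mult_ac)
  qed
  have "\<exists>R. \<forall>Z\<in>ball 0 r. (\<lambda>n. f n Z) sums R Z \<and> (R has_derivative R' Z) (at Z within ball 0 r)"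
  proof (rule has_derivative_series)
    show "(f n has_derivative f' n Z) (at Z within ball 0 r)" for n Z
      unfolding f_def f'_def by (intro has_derivative_scaleR_right has_derivative_mat_pow)
    show "\<forall>\<^sub>F n in sequentially. \<forall>Z\<in>ball 0 r. \<forall>H. norm ((\<Sum>i<n. f' i Z H) - R' Z H) \<le> e * norm H"
      if "e > 0" for e
    proof -
      have "(\<lambda>n. M * (1/2) ^ n) \<longlonglongrightarrow> M * 0"
        by (intro tendsto_intros LIMSEQ_realpow_zero) auto
      then have "\<forall>\<^sub>F n in sequentially. M * (1/2) ^ n < e"
        using that by (intro order_tendstoD) auto
      then show ?thesis
      proof eventually_elim
        case (elim n)
        then show ?case
          using tail by (meson order.trans mult_right_mono norm_ge_zero less_imp_le)
      qed
    qed
    \<comment> \<open>The series must converge at one point; at \<open>0\<close> every term is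
      zero.\<close>
    show "(\<lambda>n. f n 0) sums 0"
      by (simp add: f_def numeral_3_eq_3)
  qed (use \<open>r > 0\<close> in auto)
  then obtain R where R: "\<And>Z. Z \<in> ball 0 r \<Longrightarrow> (\<lambda>n. f n Z) sums R Z"
    and R_deriv: "\<And>Z. Z \<in> ball 0 r \<Longrightarrow> (R has_derivative R' Z) (at Z within ball 0 r)"
    by blast
  show ?thesis
  proof (rule that [OF \<open>r > 0\<close> _ _ _ R'_le])
    fix Z :: "complex^'n^'n"
    assume Z: "Z \<in> ball 0 r"
    \<comment> \<open>The terms of index \<open>0\<close>, \<open>1\<close>, \<open>2\<close> are
      put back: zero because \<open>ln_coeff 0 = 0\<close>, then \<open>Z\<close> and
      \<open>- (1/2) *\<^sub>R (Z ** Z)\<close>.\<close>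
    have "(\<lambda>n. ln_coeff n *\<^sub>R mat_pow Z n) sums (R Z + (\<Sum>i<3. ln_coeff i *\<^sub>R mat_pow Z i))"
      using R [OF Z] unfolding f_def by (rule sums_iff_shift [THEN iffD1])
    then show "(\<lambda>n. ln_coeff n *\<^sub>R mat_pow Z n) sums (Z - (1/2) *\<^sub>R (Z ** Z) + R Z)"
      by (simp add: numeral_3_eq_3 ln_coeff_def algebra_simps)
    have "(\<lambda>n. c * (K * norm Z) ^ n) \<longlonglongrightarrow> c * 0"
      using small [OF Z] \<open>K > 0\<close> by (intro tendsto_intros LIMSEQ_realpow_zero) auto
    then have lim: "(\<lambda>n. c * (K * norm Z) ^ n) \<longlonglongrightarrow> 0"
      by simp
    have "norm (mat_pow Z n) \<le> c * (K * norm Z) ^ n" for n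
      unfolding c_def by (rule norm_mat_pow_le [OF K]) (use \<open>K > 0\<close> in simp)
    then show "(\<lambda>n. mat_pow Z n) \<longlonglongrightarrow> 0"
      by (intro Lim_null_comparison [OF _ lim]) simp
    show "(R has_derivative R' Z) (at Z)"
      using R_deriv [OF Z] at_within_open [OF Z open_ball] by simp
  qed
qed

lemma mat_pow_spectral_matrix:
  assumes "unitary U"
  shows "mat_pow (spectral_matrix U d) n = spectral_matrix U (\<lambda>i. d i ^ n)"
  by (induction n) (simp_all add: spectral_matrix_1 spectral_matrix_mult assms)

text \<open>Decay of the powers forces every \<open>e i - 1\<close> strictly between -1 and 1, where
  the scalar logarithm series holds eigenvalue by eigenvalue.\<close>

lemma spectral_matrix_ln_eq_series:
  fixes U :: "complex^'n^'n"
  assumes U: "unitary U" and pow: "(\<lambda>n. mat_pow (spectral_matrix U e - mat 1) n) \<longlonglongrightarrow> 0"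
  shows "(\<lambda>n. ln_coeff n *\<^sub>R mat_pow (spectral_matrix U e - mat 1) n) sums
    spectral_matrix U (\<lambda>i. ln (e i))"
proof -
  have Z: "spectral_matrix U e - mat 1 = spectral_matrix U (\<lambda>i. e i - 1)"
    by (simp add: spectral_matrix_1 [OF U, symmetric] spectral_matrix_diff)
  have small: "\<bar>e i - 1\<bar> < 1" for i
  proof (rule ccontr)
    assume "\<not> \<bar>e i - 1\<bar> < 1"
    \<comment> \<open>Conjugation by \<open>U\<close> exposes the powers of the eigenvalues as
      diagonal entries.\<close>
    have "(\<lambda>n. (conj_transpose U ** mat_pow (spectral_matrix U e - mat 1) n ** U) $ i $ i)
        \<longlonglongrightarrow> (conj_transpose U ** 0 ** U) $ i $ i"
      by (intro tendsto_vec_nth matmul.tendsto tendsto_const pow)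
    moreover have "conj_transpose U ** spectral_matrix U d ** U = diag_matrix d" for d
      using U unfolding spectral_matrix_def unitary_def
      by (metis matrix_mul_assoc matrix_mul_rid matrix_mul_lid)
    ultimately have "(\<lambda>n. complex_of_real ((e i - 1) ^ n)) \<longlonglongrightarrow> complex_of_real 0"
      by (simp add: Z mat_pow_spectral_matrix [OF U] diag_matrix_def)
    then have "(\<lambda>n. (e i - 1) ^ n) \<longlonglongrightarrow> 0"
      by (simp only: tendsto_of_real_iff)
    then have "(\<lambda>n. norm ((e i - 1) ^ n)) \<longlonglongrightarrow> 0"
      by (rule tendsto_norm_zero)
    then have "\<forall>\<^sub>F n in sequentially. norm ((e i - 1) ^ n) < 1"
      by (rule order_tendstoD) simp
    then obtain n where "\<bar>e i - 1\<bar> ^ n < 1"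
      by (auto simp: eventually_sequentially power_abs)
    then show False
      using \<open>\<not> \<bar>e i - 1\<bar> < 1\<close> by (meson not_less one_le_power)
  qed
  have "(\<lambda>n. ln_coeff n * (e i - 1) ^ n) sums ln (e i)" for i
    using ln_series' [OF small, of i] by (simp add: ln_coeff_def power_minus [of "e i - 1"] flip: power_mult_distrib)
  then show ?thesis
    unfolding Z mat_pow_spectral_matrix [OF U] spectral_matrix_scaleR
    by (rule sums_spectral_matrix)
qed

subsection \<open>Second-order expansion of the relative entropy\<close>

text \<open>The argument of the logarithm is the inverse of \<open>mat 1 + Z\<close>. The remainder
  \<open>T\<close> is left abstract: it is whatever completes the first two terms to the sum of the
  series.\<close>

lemma BS_relative_entropy_expansion:
  fixes \<rho> \<sigma> T :: "complex^'n^'n"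
  defines "Q \<equiv> matrix_fun (\<lambda>x. 1 / sqrt x) \<rho>"
  defines "Z \<equiv> Q ** (\<sigma> - \<rho>) ** Q"
  assumes \<rho>: "pos_def \<rho>" and \<sigma>: "pos_def \<sigma>" and tr: "trace \<sigma> = trace \<rho>"
    and sums: "(\<lambda>n. ln_coeff n *\<^sub>R mat_pow Z n) sums (Z - (1/2) *\<^sub>R (Z ** Z) + T)"
    and pow: "(\<lambda>n. mat_pow Z n) \<longlonglongrightarrow> 0"
  shows "BS_relative_entropy \<rho> \<sigma> =
    Re (trace ((\<sigma> - \<rho>) ** matrix_inv \<rho> ** (\<sigma> - \<rho>))) / 2 - Re (trace (\<rho> ** T))"
proof -
  obtain U d where U: "unitary U" and \<rho>_eq: "\<rho> = spectral_matrix U d" and d: "\<And>i. 0 < d i"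
    using pos_def_spectral_decomposition [OF \<rho>] by blast
  have d_ne: "d i \<noteq> 0" for i
    using d [of i] by simp
  define S where "S = matrix_fun sqrt \<rho>"
  define P where "P = spectral_matrix U (\<lambda>i. 1 / d i)"
  have S: "S = spectral_matrix U (\<lambda>i. sqrt (d i))"
    unfolding S_def \<rho>_eq by (rule matrix_fun_spectral_matrix [OF U])
  have Q: "Q = spectral_matrix U (\<lambda>i. 1 / sqrt (d i))"
    unfolding Q_def \<rho>_eq by (rule matrix_fun_spectral_matrix [OF U])
  have SS: "S ** S = \<rho>" and QQ: "Q ** Q = P" and SQ: "S ** Q = mat 1" and QS: "Q ** S = mat 1"
    and \<rho>P: "\<rho> ** P = mat 1"
    using d d_ne
    by (simp_all add: S Q P_def \<rho>_eq spectral_matrix_mult [OF U] less_imp_le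
        flip: spectral_matrix_1 [OF U])
  have SQ': "S ** (Q ** W) = W" and QS': "Q ** (S ** W) = W" for W
    by (simp_all add: matrix_mul_assoc SQ QS)
  have P: "matrix_inv \<rho> = P"
    by (rule matrix_inv_eqI [OF \<rho>P])
  have Q_herm: "hermitian Q"
    unfolding Q by (rule hermitian_spectral_matrix)
  \<comment> \<open>This is \<open>mat 1 + Z\<close>. Congruence by the invertible \<open>Q\<close>
    keeps positive definiteness, so \<open>Y\<close> has positive eigenvalues and a
    logarithm.\<close>
  define Y where "Y = Q ** \<sigma> ** Q"
  have "pos_def Y"
    unfolding pos_def_def
  proof (intro conjI allI impI)
    show "hermitian Y"
      using Q_herm \<sigma> by (simp add: Y_def pos_def_def hermitian_def conj_transpose_mult matrix_mul_assoc)
    fix x :: "complex^'n"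
    assume "x \<noteq> 0"
    have "S *v (Q *v x) = x"
      by (simp add: matrix_vector_mul_assoc SQ)
    then have "Q *v x \<noteq> 0"
      using \<open>x \<noteq> 0\<close> matvec.zero_right [of S] by metis
    moreover have "cinner x (Y *v x) = cinner (Q *v x) (\<sigma> *v (Q *v x))"
      by (simp add: Y_def cinner_hermitian [OF Q_herm] matrix_vector_mul_assoc matrix_mul_assoc)
    ultimately show "0 < Re (cinner x (Y *v x))"
      using \<sigma> by (simp add: pos_def_def)
  qed
  then obtain V e where V: "unitary V" and Y_eq: "Y = spectral_matrix V e" and e: "\<And>i. 0 < e i"
    using pos_def_spectral_decomposition by blast
  have e_ne: "e i \<noteq> 0" for i
    using e [of i] by simp
  define Y' where "Y' = spectral_matrix V (\<lambda>i. 1 / e i)"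
  have YY': "Y ** Y' = mat 1"
    unfolding Y_eq Y'_def by (rule spectral_matrix_mult_inverse [OF V e_ne])
  have "\<sigma> = S ** Y ** S"
    by (simp add: Y_def SQ' QS matrix_mul_assoc [symmetric])
  then have "\<sigma> ** (Q ** Y' ** Q) = S ** (Y ** Y') ** Q"
    by (simp add: SQ' matrix_mul_assoc [symmetric])
  then have "matrix_inv \<sigma> = Q ** Y' ** Q"
    by (intro matrix_inv_eqI) (simp add: YY' SQ)
  then have "S ** matrix_inv \<sigma> ** S = Y'"
    by (simp add: SQ' QS matrix_mul_assoc [symmetric])
  then have ln_eq: "matrix_fun ln (S ** matrix_inv \<sigma> ** S) = - spectral_matrix V (\<lambda>i. ln (e i))"
    by (simp add: Y'_def matrix_fun_spectral_matrix [OF V] spectral_matrix_uminus ln_div e_ne)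
  have Z_eq: "Z = spectral_matrix V e - mat 1"
  proof -
    have "Q ** \<rho> ** Q = mat 1"
      by (simp add: SS [symmetric] matrix_mul_assoc [symmetric] SQ' QS' SQ QS)
    then show ?thesis
      by (simp add: Z_def Y_eq [symmetric] Y_def matmul.diff_left matmul.diff_right)
  qed
  have "spectral_matrix V (\<lambda>i. ln (e i)) = Z - (1/2) *\<^sub>R (Z ** Z) + T"
    using spectral_matrix_ln_eq_series [OF V, of e] sums_unique2 [OF _ sums] pow
    unfolding Z_eq by blast
  then have "BS_relative_entropy \<rho> \<sigma> = Re (trace (\<rho> ** - (Z - (1/2) *\<^sub>R (Z ** Z) + T)))"
    unfolding BS_relative_entropy_def S_def [symmetric] ln_eq by simp
  also have "\<rho> ** - (Z - (1/2) *\<^sub>R (Z ** Z) + T) = (1/2) *\<^sub>R (\<rho> ** (Z ** Z)) - \<rho> ** Z - \<rho> ** T"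
    by (simp add: matmul.minus_right matmul.add_right matmul.diff_right matmul.scaleR_right)
  also have "Re (trace \<dots>) = Re (trace (\<rho> ** (Z ** Z))) / 2 - Re (trace (\<rho> ** Z)) - Re (trace (\<rho> ** T))"
    by (simp add: trace_sub trace_def [of "(1/2) *\<^sub>R _"] trace_def [of "\<rho> ** (Z ** Z)"] sum_divide_distrib)
  \<comment> \<open>Writing \<rho> as \<open>S ** S\<close> cancels the first \<open>Q\<close>. What
    remains is a conjugation by \<open>S\<close>, which preserves the trace, so equal traces remove
    the linear term.\<close>
  also have "\<rho> ** Z = S ** (\<sigma> - \<rho>) ** Q"
    by (simp add: Z_def SS [symmetric] matrix_mul_assoc [symmetric] SQ')
  also have "trace \<dots> = trace (\<sigma> - \<rho>)"
    by (simp add: trace_mul_sym [of _ Q] matrix_mul_assoc QS)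
  also have "\<dots> = 0"
    by (simp add: trace_sub tr)
  also have "\<rho> ** (Z ** Z) = S ** ((\<sigma> - \<rho>) ** P ** (\<sigma> - \<rho>)) ** Q"
    by (simp add: Z_def SS [symmetric] QQ [symmetric] matrix_mul_assoc [symmetric] SQ')
  also have "trace \<dots> = trace ((\<sigma> - \<rho>) ** P ** (\<sigma> - \<rho>))"
    by (simp add: trace_mul_sym [of _ Q] matrix_mul_assoc QS)
  finally show ?thesis
    by (simp add: P)
qed

section \<open>Partial derivatives and quadratically small remainders\<close>

lemma partial_deriv_eq:
  assumes "(f has_derivative f') (at x)"
  shows "partial_deriv i f x = f' (axis i 1)"
proof -
  have "((\<lambda>t. x + t *\<^sub>R axis i 1) has_derivative (\<lambda>t. t *\<^sub>R axis i 1)) (at 0)"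
    by (auto intro!: derivative_eq_intros)
  then have "((\<lambda>t. f (x + t *\<^sub>R axis i 1)) has_derivative (\<lambda>t. f' (t *\<^sub>R axis i 1))) (at 0)"
    by (rule has_derivative_compose) (use assms in simp)
  then have "((\<lambda>t. f (x + t *\<^sub>R axis i 1)) has_vector_derivative f' (axis i 1)) (at 0)"
    by (simp add: has_vector_derivative_def linear_scale [OF has_derivative_linear [OF assms]])
  then show ?thesis
    unfolding partial_deriv_def by (rule vector_derivative_at)
qed

text \<open>\<open>Z\<close> is differentiable and vanishes at \<open>x\<close>, so its squared norm
  is negligible against the distance to \<open>x\<close>, while \<open>a\<close> stays bounded
  nearby. Applied to first derivatives of the remainder, this yields its second derivatives at the
  base point without differentiating the series twice.\<close>

lemma has_derivative_zero_if_quadratically_small: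
  fixes Z :: "'a::real_normed_vector \<Rightarrow> 'b::real_inner"
    and a :: "'a \<Rightarrow> 'c::real_normed_vector" and w :: "'a \<Rightarrow> 'd::real_normed_vector"
  assumes Z: "(Z has_derivative Z') (at x)" "Z x = 0" and a: "isCont a x"
    and w: "\<forall>\<^sub>F y in nhds x. norm (w y) \<le> c * (norm (Z y))\<^sup>2 * norm (a y)"
  shows "(w has_derivative (\<lambda>_. 0)) (at x)"
  unfolding has_derivative_iff_norm
proof
  \<comment> \<open>The estimate also holds at \<open>x\<close> itself, as the filter is
    \<open>nhds x\<close>.\<close>
  have "w x = 0"
    using eventually_nhds_x_imp_x [OF w] Z(2) by simp
  have "((\<lambda>y. Z y \<bullet> Z y) has_derivative (\<lambda>_. 0)) (at x)"
    using has_derivative_inner [OF Z(1) Z(1)] Z(2) by simp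
  then have "((\<lambda>y. (norm (Z y))\<^sup>2 / norm (y - x)) \<longlongrightarrow> 0) (at x)"
    using Z(2) by (simp add: has_derivative_iff_norm power2_norm_eq_inner)
  then have "((\<lambda>y. c * ((norm (Z y))\<^sup>2 / norm (y - x)) * norm (a y)) \<longlongrightarrow> c * 0 * norm (a x)) (at x)"
    using a by (intro tendsto_intros) (auto simp: isCont_def)
  then have lim: "((\<lambda>y. c * ((norm (Z y))\<^sup>2 / norm (y - x)) * norm (a y)) \<longlongrightarrow> 0) (at x)"
    by simp
  have "\<forall>\<^sub>F y in at x. norm (norm (w y - w x - 0) / norm (y - x))
      \<le> c * ((norm (Z y))\<^sup>2 / norm (y - x)) * norm (a y)"
    using w [unfolded eventually_nhds_conv_at, THEN conjunct1]
  proof eventually_elim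
    case (elim y)
    then show ?case
      using divide_right_mono [OF elim norm_ge_zero [of "y - x"]] \<open>w x = 0\<close> by (simp add: mult_ac)
  qed
  then show "((\<lambda>y. norm (w y - w x - 0) / norm (y - x)) \<longlongrightarrow> 0) (at x)"
    by (rule Lim_null_comparison [OF _ lim])
qed (rule bounded_linear_zero)

text \<open>The adjoint is real-linear, hence commutes with differentiation, and derivatives are
  unique.\<close>

lemma hermitian_frechet_derivative:
  assumes "\<And>x. hermitian (f x)" and "(f has_derivative f') (at x)"
  shows "hermitian (f' h)"
proof -
  have "((\<lambda>x. conj_transpose (f x)) has_derivative (\<lambda>h. conj_transpose (f' h))) (at x)"
    by (rule bounded_linear.has_derivative [OF bounded_linear_conj_transpose assms(2)])
  then have "(\<lambda>h. conj_transpose (f' h)) = f'"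
    using assms unfolding hermitian_def by (intro has_derivative_unique [of f _ x]) auto
  then show ?thesis
    by (simp add: hermitian_def fun_eq_iff)
qed

section \<open>Second derivatives of the entropy at the base point\<close>

theorem theorem7:
  fixes \<rho> :: "real^'l \<Rightarrow> complex^'n^'n"
  assumes "\<And>\<theta>. state (\<rho> \<theta>)"
    and "\<And>\<theta>. pos_def (\<rho> \<theta>)"
    and "twice_differentiable \<rho>"
  shows "\<forall>\<theta>. BS_information \<rho> \<theta> = RLD_information \<rho> \<theta>"
proof
  fix \<theta>
  obtain \<rho>' where \<rho>': "\<And>x. (\<rho> has_derivative blinfun_apply (\<rho>' x)) (at x)"
    and \<rho>'_diff: "\<And>x. \<rho>' differentiable (at x)"
    using assms(3) unfolding twice_differentiable_def by blast
  obtain r C and R :: "complex^'n^'n \<Rightarrow> complex^'n^'n" and R' where "r > 0"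
    and series: "\<And>Z. Z \<in> ball 0 r \<Longrightarrow>
      (\<lambda>n. ln_coeff n *\<^sub>R mat_pow Z n) sums (Z - (1/2) *\<^sub>R (Z ** Z) + R Z)"
    and pow: "\<And>Z :: complex^'n^'n. Z \<in> ball 0 r \<Longrightarrow> (\<lambda>n. mat_pow Z n) \<longlonglongrightarrow> 0"
    and R: "\<And>Z. Z \<in> ball 0 r \<Longrightarrow> (R has_derivative R' Z) (at Z)"
    and R'_le: "\<And>Z H. Z \<in> ball 0 r \<Longrightarrow> norm (R' Z H) \<le> C * (norm Z)\<^sup>2 * norm H"
    by (rule matrix_ln_series_remainder) (rule that)
  define Q where "Q = matrix_fun (\<lambda>x. 1 / sqrt x) (\<rho> \<theta>)"
  define P where "P = matrix_inv (\<rho> \<theta>)"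
  define \<Delta> where "\<Delta> \<epsilon> = \<rho> (\<theta> + \<epsilon>) - \<rho> \<theta>" for \<epsilon>
  define Z where "Z \<epsilon> = Q ** \<Delta> \<epsilon> ** Q" for \<epsilon>
  \<comment> \<open>The parameters for which the series applies. As an open neighbourhood of
    \<open>0\<close>, it allows derivatives to be computed from the expansion.\<close>
  define N where "N = Z -` ball 0 r"
  define F where "F \<epsilon> = BS_relative_entropy (\<rho> \<theta>) (\<rho> (\<theta> + \<epsilon>))" for \<epsilon>
  \<comment> \<open>Symmetrising makes the derivative of
    \<open>B (\<Delta> \<epsilon>) (\<Delta> \<epsilon>) / 2\<close> a single term.\<close>
  define B where "B A A' = (Re (trace (A ** P ** A')) + Re (trace (A' ** P ** A))) / 2" for A A'
  define L where "L A = Re (trace (\<rho> \<theta> ** A))" for A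
  have L: "bounded_linear L"
    unfolding L_def
    by (rule bounded_linear_compose [OF bounded_linear_Re_trace matmul.bounded_linear_right])
  have QQ: "bounded_linear (\<lambda>A. Q ** A ** Q)"
    by (rule bounded_linear_compose [OF matmul.bounded_linear_left matmul.bounded_linear_right])
  have \<Delta>: "(\<Delta> has_derivative \<rho>' (\<theta> + \<epsilon>)) (at \<epsilon>)" for \<epsilon>
  proof -
    have "((\<lambda>\<epsilon>. \<theta> + \<epsilon>) has_derivative (\<lambda>h. h)) (at \<epsilon>)"
      by (auto intro!: derivative_eq_intros)
    then have "((\<lambda>\<epsilon>. \<rho> (\<theta> + \<epsilon>)) has_derivative \<rho>' (\<theta> + \<epsilon>)) (at \<epsilon>)"
      by (rule has_derivative_compose) (rule \<rho>')
    then show ?thesis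
      unfolding \<Delta>_def [abs_def] by (auto intro!: derivative_eq_intros)
  qed
  have Z: "(Z has_derivative (\<lambda>h. Q ** \<rho>' (\<theta> + \<epsilon>) h ** Q)) (at \<epsilon>)" for \<epsilon>
    unfolding Z_def [abs_def] by (rule bounded_linear.has_derivative [OF QQ \<Delta>])
  have \<Delta>0: "\<Delta> 0 = 0"
    by (simp add: \<Delta>_def)
  then have Z0: "Z 0 = 0"
    by (simp add: Z_def)
  have B0: "B 0 A = 0" for A
    by (simp add: B_def trace_def)
  have "open N"
    unfolding N_def using has_derivative_continuous [OF Z]
    by (intro continuous_open_vimage) (auto simp: continuous_at_imp_continuous_on)
  have "0 \<in> N"
    using \<open>r > 0\<close> by (simp add: N_def Z0)
  have B: "((\<lambda>\<epsilon>. B (f \<epsilon>) (g \<epsilon>)) has_derivative (\<lambda>h. B (f x) (g' h) + B (f' h) (g x))) (at x)"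
    if "(f has_derivative f') (at x)" "(g has_derivative g') (at x)" for f g f' g' and x :: "real^'l"
  proof -
    have "((\<lambda>\<epsilon>. f \<epsilon> ** P ** g \<epsilon> + g \<epsilon> ** P ** f \<epsilon>) has_derivative
        (\<lambda>h. (f x ** P ** g' h + f' h ** P ** g x) + (g x ** P ** f' h + g' h ** P ** f x))) (at x)"
      using that
      by (intro has_derivative_add matmul.FDERIV
          bounded_linear.has_derivative [OF matmul.bounded_linear_left])
    then have "((\<lambda>\<epsilon>. Re (trace (f \<epsilon> ** P ** g \<epsilon> + g \<epsilon> ** P ** f \<epsilon>)) / 2) has_derivative
        (\<lambda>h. Re (trace ((f x ** P ** g' h + f' h ** P ** g x) + (g x ** P ** f' h + g' h ** P ** f x))) / 2))
        (at x)"
      by (intro bounded_linear.has_derivative [OF bounded_linear_divide]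
          bounded_linear.has_derivative [OF bounded_linear_Re_trace])
    then show ?thesis
      by (simp add: B_def trace_add add_divide_distrib algebra_simps)
  qed
  have F_eq: "F \<epsilon> = B (\<Delta> \<epsilon>) (\<Delta> \<epsilon>) / 2 - L (R (Z \<epsilon>))" if "\<epsilon> \<in> N" for \<epsilon>
  proof -
    have "Z \<epsilon> \<in> ball 0 r"
      using that by (simp add: N_def)
    then show ?thesis
      using BS_relative_entropy_expansion [OF assms(2) assms(2), of "\<theta> + \<epsilon>" \<theta>] series pow assms(1)
      by (simp add: F_def B_def L_def state_def flip: P_def Q_def \<Delta>_def Z_def)
  qed
  have F: "(F has_derivative (\<lambda>h. B (\<Delta> \<epsilon>) (\<rho>' (\<theta> + \<epsilon>) h)
      - L (R' (Z \<epsilon>) (Q ** \<rho>' (\<theta> + \<epsilon>) h ** Q)))) (at \<epsilon>)" if "\<epsilon> \<in> N" for \<epsilon>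
  proof -
    have "(R has_derivative R' (Z \<epsilon>)) (at (Z \<epsilon>))"
      using that by (intro R) (simp add: N_def)
    then have "((\<lambda>\<epsilon>. L (R (Z \<epsilon>))) has_derivative (\<lambda>h. L (R' (Z \<epsilon>) (Q ** \<rho>' (\<theta> + \<epsilon>) h ** Q)))) (at \<epsilon>)"
      by (intro bounded_linear.has_derivative [OF L] has_derivative_compose [OF Z])
    then have "((\<lambda>\<epsilon>. B (\<Delta> \<epsilon>) (\<Delta> \<epsilon>) / 2 - L (R (Z \<epsilon>))) has_derivative
        (\<lambda>h. (B (\<Delta> \<epsilon>) (\<rho>' (\<theta> + \<epsilon>) h) + B (\<rho>' (\<theta> + \<epsilon>) h) (\<Delta> \<epsilon>)) / 2
          - L (R' (Z \<epsilon>) (Q ** \<rho>' (\<theta> + \<epsilon>) h ** Q)))) (at \<epsilon>)"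
      by (intro has_derivative_diff bounded_linear.has_derivative [OF bounded_linear_divide] B \<Delta>)
    moreover have "B A A' = B A' A" for A A'
      by (simp add: B_def add.commute)
    ultimately have "((\<lambda>\<epsilon>. B (\<Delta> \<epsilon>) (\<Delta> \<epsilon>) / 2 - L (R (Z \<epsilon>))) has_derivative
        (\<lambda>h. B (\<Delta> \<epsilon>) (\<rho>' (\<theta> + \<epsilon>) h) - L (R' (Z \<epsilon>) (Q ** \<rho>' (\<theta> + \<epsilon>) h ** Q)))) (at \<epsilon>)"
      by simp
    then show ?thesis
      by (rule has_derivative_transform_within_open [OF _ \<open>open N\<close> that]) (simp add: F_eq)
  qed
  have "partial_deriv i (partial_deriv j F) 0 = B (\<rho>' \<theta> (axis i 1)) (\<rho>' \<theta> (axis j 1))" for i j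
  proof -
    \<comment> \<open>With \<open>a\<close> the derivative of the family in direction
      \<open>j\<close> and \<open>W\<close> that of the remainder, the first partial derivative of
      \<open>F\<close> on \<open>N\<close> is
      \<open>B (\<Delta> \<epsilon>) (a \<epsilon>) - W \<epsilon>\<close>.\<close>
    define a where "a \<epsilon> = \<rho>' (\<theta> + \<epsilon>) (axis j 1)" for \<epsilon>
    define W where "W \<epsilon> = L (R' (Z \<epsilon>) (Q ** a \<epsilon> ** Q))" for \<epsilon>
    obtain \<rho>'' where \<rho>'': "(\<rho>' has_derivative \<rho>'') (at (\<theta> + 0))"
      using \<rho>'_diff unfolding differentiable_def by blast
    have "((\<lambda>\<epsilon>. \<theta> + \<epsilon>) has_derivative (\<lambda>h. h)) (at 0)"
      by (auto intro!: derivative_eq_intros)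
    then have "((\<lambda>\<epsilon>. \<rho>' (\<theta> + \<epsilon>)) has_derivative \<rho>'') (at 0)"
      by (rule has_derivative_compose) (rule \<rho>'')
    then have a: "(a has_derivative (\<lambda>h. \<rho>'' h (axis j 1))) (at 0)"
      unfolding a_def [abs_def]
      by (rule bounded_linear.has_derivative [OF blinfun.bounded_linear_left])
    obtain K where "K > 0" and K: "\<And>A. norm (L A) \<le> norm A * K"
      using bounded_linear.pos_bounded [OF L] by blast
    have "norm (W \<epsilon>) \<le> (C * K) * (norm (Z \<epsilon>))\<^sup>2 * norm (Q ** a \<epsilon> ** Q)" if "\<epsilon> \<in> N" for \<epsilon>
    proof -
      have "norm (R' (Z \<epsilon>) (Q ** a \<epsilon> ** Q)) \<le> C * (norm (Z \<epsilon>))\<^sup>2 * norm (Q ** a \<epsilon> ** Q)"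
        using that by (intro R'_le) (simp add: N_def)
      from mult_right_mono [OF this less_imp_le [OF \<open>K > 0\<close>]] show ?thesis
        unfolding W_def by (intro order.trans [OF K]) (simp add: mult_ac)
    qed
    then have "\<forall>\<^sub>F \<epsilon> in nhds 0. norm (W \<epsilon>) \<le> (C * K) * (norm (Z \<epsilon>))\<^sup>2 * norm (Q ** a \<epsilon> ** Q)"
      using eventually_nhds_in_open [OF \<open>open N\<close> \<open>0 \<in> N\<close>] by (rule eventually_mono [rotated])
    moreover have "isCont (\<lambda>\<epsilon>. Q ** a \<epsilon> ** Q) 0"
      by (rule has_derivative_continuous [OF bounded_linear.has_derivative [OF QQ a]])
    ultimately have "(W has_derivative (\<lambda>_. 0)) (at 0)"
      by (intro has_derivative_zero_if_quadratically_small [OF Z Z0])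
    \<comment> \<open>Since \<open>\<Delta> 0 = 0\<close>, the term with the second derivative of
      the family drops out and only first derivatives remain.\<close>
    then have "((\<lambda>\<epsilon>. B (\<Delta> \<epsilon>) (a \<epsilon>) - W \<epsilon>) has_derivative
        (\<lambda>h. B (\<Delta> 0) (\<rho>'' h (axis j 1)) + B (\<rho>' (\<theta> + 0) h) (a 0) - 0)) (at 0)"
      by (intro has_derivative_diff B \<Delta> a)
    then have "((\<lambda>\<epsilon>. B (\<Delta> \<epsilon>) (a \<epsilon>) - W \<epsilon>) has_derivative (\<lambda>h. B (\<rho>' \<theta> h) (\<rho>' \<theta> (axis j 1)))) (at 0)"
      by (simp add: \<Delta>0 B0 a_def)
    then have "(partial_deriv j F has_derivative (\<lambda>h. B (\<rho>' \<theta> h) (\<rho>' \<theta> (axis j 1)))) (at 0)"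
      by (rule has_derivative_transform_within_open [OF _ \<open>open N\<close> \<open>0 \<in> N\<close>])
        (simp add: partial_deriv_eq [OF F] a_def W_def)
    then show ?thesis
      by (rule partial_deriv_eq)
  qed
  \<comment> \<open>Hermiticity makes the two summands of \<open>B\<close> equal, so the symmetrised
    form is the RLD entry.\<close>
  moreover have "hermitian (\<rho>' \<theta> h)" for h
    using hermitian_frechet_derivative [OF _ \<rho>'] assms(2) by (simp add: pos_def_def)
  moreover have "hermitian P"
    unfolding P_def by (rule hermitian_matrix_inv_pos_def [OF assms(2)])
  ultimately show "BS_information \<rho> \<theta> = RLD_information \<rho> \<theta>"
    using Re_trace_mult3_hermitian [of "\<rho>' \<theta> _" P "\<rho>' \<theta> _"]
    by (simp add: BS_information_def RLD_information_def B_def vec_eq_iff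
        partial_deriv_eq [OF \<rho>'] flip: F_def [abs_def] P_def)
qed

end
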